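(* Let $\mathrm{Re}(x)>0$. Then $$T(x)+T\left(\frac1x\right)=\frac{\pi^2}{16}.$$
   Context: For $\mathrm{Re}(x)>0$, $T(x)=\int_0^1\frac{\tan^{-1}(t^x)}{1+t^2}\,dt$ (principal branch of $\tan^{-1}$). *)

theory Defs
  imports "HOL-Analysis.Analysis"
begin

text \<open>
  \<^const>\<open>Arctan\<close> is the principal branch of the complex inverse tangent, with cuts on the
  imaginary axis outside the open unit disc. For real \<open>0 < t\<close>, \<open>of_real t powr x\<close> is
  \<open>exp (x * ln t)\<close>, and \<open>0 powr x = 0\<close>.
\<close>

definition T :: "complex \<Rightarrow> complex" where
  "T x = integral {0..1} (\<lambda>t::real. Arctan (of_real t powr x) / (1 + (of_real t)\<^sup>2))"

end

theory Submission
  imports Defs "HOL-Complex_Analysis.Complex_Analysis" "HOL-Real_Asymp.Real_Asymp"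
begin

text \<open>
  For real \<open>x > 0\<close> the identity is integration by parts followed by a change of variables:
  the substitution \<open>u = t\<^sup>x\<close> turns \<open>T (1/x)\<close> into the integral of
  \<open>arctan t * (d/dt) arctan (t\<^sup>x)\<close>, so the two terms together are the integral of
  the derivative of \<open>arctan t * arctan (t\<^sup>x)\<close> over the unit interval, which is
  \<open>(pi/4)\<^sup>2\<close>.

  For complex \<open>x\<close> the same substitution would bend the path of integration into a logarithmic
  spiral. Instead, the identity is continued analytically from the positive axis:
  \<open>T\<close> is holomorphic on the right half-plane by differentiation under the integral sign
  (\<open>T_holomorphic\<close>), the half-plane is invariant under \<open>x \<mapsto> 1/x\<close>, and a holomorphic
  function on it is determined by its values on the positive axis (\<open>T_reflection_real\<close>).
\<close>

section \<open>Holomorphy on the right half-plane\<close>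

text \<open>
  The branch points \<open>\<plusminus>\<i>\<close> of \<^const>\<open>Arctan\<close> lie on the unit circle, and a power of
  \<open>t \<in> [0,1]\<close> reaches that circle only for \<open>t = 1\<close>, at the point 1. Hence
  \<^const>\<open>Arctan\<close> is differentiable at every value that occurs in the integrand.
\<close>

lemma powr_avoids_Arctan_cut:
  fixes x :: complex
  assumes "Re x > 0" "0 \<le> t" "t \<le> 1" "Re (of_real t powr x) = 0"
  shows "\<bar>Im (of_real t powr x)\<bar> < 1"
proof -
  have "t \<noteq> 1"
    using assms(4) by auto
  with assms have "t powr Re x < 1 powr Re x"
    by (intro powr_less_mono2) auto
  then have "norm (of_real t powr x) < 1"
    using assms by (simp add: norm_powr_real_powr)
  then show ?thesis
    using abs_Im_le_cmod order_le_less_trans by blast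
qed

lemma one_plus_powr_squared_nonzero:
  fixes x :: complex
  assumes "Re x > 0" "0 \<le> t" "t \<le> 1"
  shows "1 + (of_real t powr x)\<^sup>2 \<noteq> 0"
proof
  assume "1 + (of_real t powr x)\<^sup>2 = 0"
  then have "(of_real t powr x)\<^sup>2 = \<i>\<^sup>2"
    by (simp add: add_eq_0_iff)
  then have "of_real t powr x = \<i> \<or> of_real t powr x = - \<i>"
    by (simp only: power2_eq_iff)
  then show False
    using powr_avoids_Arctan_cut[OF assms] by auto
qed

lemma one_plus_of_real_squared_nonzero: "1 + (complex_of_real t)\<^sup>2 \<noteq> 0"
proof -
  have "1 + t\<^sup>2 \<noteq> 0"
    using zero_le_power2[of t] by linarith
  then show ?thesis
    by (metis of_real_1 of_real_add of_real_eq_0_iff of_real_power)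
qed

lemma continuous_on_T_integrand:
  fixes x :: complex
  assumes "Re x > 0"
  shows "continuous_on {0..1} (\<lambda>t::real. Arctan (of_real t powr x) / (1 + (of_real t)\<^sup>2))"
proof -
  have "continuous_on {0..1} (\<lambda>t::real. of_real t powr x)"
    using assms by (intro continuous_intros) auto
  then have "continuous_on {0..1} (\<lambda>t::real. Arctan (of_real t powr x))"
    by (rule continuous_on_compose2[rotated, where t = "(\<lambda>t. of_real t powr x) ` {0..1}"])
       (use powr_avoids_Arctan_cut[OF assms] in \<open>auto intro!: continuous_on_Arctan\<close>)
  then show ?thesis
    by (intro continuous_intros one_plus_of_real_squared_nonzero ballI)
qed

lemma continuous_on_powr_times_ln:
  fixes d :: real
  assumes "d > 0"
  shows "continuous_on {0..1} (\<lambda>t. t powr d * ln t)"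
  unfolding continuous_on_def
proof
  fix t :: real assume "t \<in> {0..1}"
  show "((\<lambda>t. t powr d * ln t) \<longlongrightarrow> t powr d * ln t) (at t within {0..1})"
  proof (cases "t = 0")
    case True
    have "((\<lambda>t. t powr d * ln t) \<longlongrightarrow> 0) (at_right 0)"
      using assms by real_asymp
    then show ?thesis
      using True by (simp add: at_within_Icc_at_right)
  next
    case False
    then show ?thesis
      using \<open>t \<in> {0..1}\<close> by (intro tendsto_intros) auto
  qed
qed

text \<open>
  Differentiating the integrand in \<open>x\<close> produces the factor \<open>t\<^sup>x ln t\<close>. On a
  half-plane \<open>Re x > d\<close> with \<open>d > 0\<close> it splits as \<open>t\<^bsup>x-d\<^esup> * (t\<^sup>d ln t)\<close>, two
  factors that are continuous up to \<open>t = 0\<close>; this gives the joint continuity that the Leibniz rule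
  needs, and the margin \<open>d\<close> is then removed by taking the union over all such half-planes.
\<close>

lemma T_holomorphic: "T holomorphic_on {x. Re x > 0}"
proof -
  have "T holomorphic_on {x. Re x > d}" if "d > 0" for d :: real
  proof -
    define U where "U = {x. Re x > d}"
    define f where "f x t = Arctan (of_real t powr x) / (1 + (of_real t)\<^sup>2)"
      for x :: complex and t :: real
    define D where
      "D x t = of_real t powr (x - of_real d) * of_real (t powr d * ln t) /
         (1 + (of_real t powr x)\<^sup>2) / (1 + (of_real t)\<^sup>2)"
      for x :: complex and t :: real
    have pos: "Re x > 0" if "x \<in> U" for x
      using that \<open>d > 0\<close> by (auto simp: U_def)
    have deriv: "((\<lambda>x. f x t) has_field_derivative D x t) (at x within U)"
      if "x \<in> U" "t \<in> cbox 0 1" for x t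
    proof (cases "t = 0")
      case True
      then show ?thesis
        by (simp add: f_def D_def)
    next
      case False
      with that have t: "0 < t" "t \<le> 1" by auto
      have "((\<lambda>x. of_real t powr x) has_field_derivative Ln (of_real t) * of_real t powr x)
              (at x within U)"
        using t by (intro has_field_derivative_at_within[OF has_field_derivative_powr_right]) auto
      then have "((\<lambda>x. Arctan (of_real t powr x)) has_field_derivative
              inverse (1 + (of_real t powr x)\<^sup>2) * (Ln (of_real t) * of_real t powr x))
              (at x within U)"
        using powr_avoids_Arctan_cut[OF pos[OF that(1)], of t] t
        by (intro DERIV_chain2[OF has_field_derivative_Arctan]) auto
      then have "((\<lambda>x. f x t) has_field_derivative
              inverse (1 + (of_real t powr x)\<^sup>2) * (Ln (of_real t) * of_real t powr x) /
              (1 + (of_real t)\<^sup>2)) (at x within U)"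
        unfolding f_def by (rule DERIV_cdivide)
      moreover have "of_real t powr (x - of_real d) * of_real (t powr d) = of_real t powr x"
        using t by (simp add: powr_diff flip: powr_of_real)
      ultimately show ?thesis
        using t by (simp add: D_def Ln_of_real divide_inverse mult_ac)
    qed
    have "continuous_on (U \<times> cbox 0 1) (\<lambda>(x, t). D x t)"
    proof -
      have "continuous_on (U \<times> cbox 0 1) (\<lambda>p. complex_of_real (snd p powr d * ln (snd p)))"
        by (intro continuous_on_of_real
              continuous_on_compose2[OF continuous_on_powr_times_ln[OF \<open>d > 0\<close>]])
           (auto intro!: continuous_intros)
      moreover have "continuous_on (U \<times> cbox 0 1) (\<lambda>p. of_real (snd p) powr fst p)"
        by (intro continuous_intros) (auto simp: pos)
      moreover have
        "continuous_on (U \<times> cbox 0 1) (\<lambda>p. of_real (snd p) powr (fst p - of_real d))"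
        by (intro continuous_intros) (auto simp: U_def)
      moreover have "continuous_on (U \<times> cbox 0 1) (\<lambda>p. complex_of_real (snd p))"
        by (intro continuous_intros)
      ultimately show ?thesis
        unfolding D_def case_prod_unfold
        by (intro continuous_on_divide continuous_on_mult continuous_on_add continuous_on_power
              continuous_on_const)
           (auto simp: one_plus_of_real_squared_nonzero one_plus_powr_squared_nonzero pos)
    qed
    moreover have "f x integrable_on cbox 0 1" if "x \<in> U" for x
      using continuous_on_T_integrand[OF pos[OF that]]
      by (intro integrable_continuous) (simp add: f_def)
    moreover have "convex U"
      unfolding U_def by (rule convex_halfspace_Re_gt)
    ultimately have "(\<lambda>x. integral (cbox 0 1) (f x)) holomorphic_on U"
      using deriv by (intro leibniz_rule_holomorphic)
    then show ?thesis
      by (simp add: f_def[abs_def] U_def T_def[abs_def])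
  qed
  then have "T holomorphic_on (\<Union>d\<in>{0<..}. {x. Re x > d})"
    by (intro holomorphic_on_UN_open) (auto simp: open_halfspace_Re_gt)
  also have "(\<Union>d\<in>{0<..}. {x. Re x > d}) = {x. Re x > 0}"
    using dense by force
  finally show ?thesis .
qed

section \<open>The identity on the positive axis\<close>

lemma continuous_on_real_T_integrand:
  fixes a :: real
  assumes "a > 0"
  shows "continuous_on {0..1} (\<lambda>t. arctan (t powr a) / (1 + t\<^sup>2))"
  using assms
  by (intro continuous_intros continuous_on_powr') (auto simp: add_nonneg_eq_0_iff)

lemma T_of_real:
  fixes a :: real
  assumes "a > 0"
  shows "T (of_real a) = of_real (integral {0..1} (\<lambda>t. arctan (t powr a) / (1 + t\<^sup>2)))"
proof -
  have "((\<lambda>t. complex_of_real (arctan (t powr a) / (1 + t\<^sup>2))) has_integral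
          of_real (integral {0..1} (\<lambda>t. arctan (t powr a) / (1 + t\<^sup>2)))) {0..1}"
    using continuous_on_real_T_integrand[OF assms]
    by (intro has_integral_of_real integrable_integral integrable_continuous_interval)
  then have "((\<lambda>t::real. Arctan (of_real t powr of_real a) / (1 + (of_real t)\<^sup>2)) has_integral
          of_real (integral {0..1} (\<lambda>t. arctan (t powr a) / (1 + t\<^sup>2)))) {0..1}"
    by (rule has_integral_eq[rotated]) (simp add: powr_of_real Arctan_of_real)
  then show ?thesis
    unfolding T_def by (rule integral_unique)
qed

text \<open>
  Let the first integral run from 0 to \<open>s\<close> and the second from 0 to \<open>s\<^sup>a\<close>. Since
  \<open>(s\<^sup>a)\<^bsup>1/a\<^esup> = s\<close>, their derivatives in \<open>s\<close> are the two halves of the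
  product rule for \<open>arctan s * arctan (s\<^sup>a)\<close>. Comparing the sum with this product at
  both ends of the unit interval performs the integration by parts and the substitution in one step,
  and the derivatives are required in the open interval only, so the singularity of
  \<open>s\<^bsup>a-1\<^esup>\<close> at 0 for \<open>a < 1\<close> does no harm.
\<close>

lemma integral_arctan_powr_reflection:
  fixes a :: real
  assumes "a > 0"
  shows "integral {0..1} (\<lambda>t. arctan (t powr a) / (1 + t\<^sup>2)) +
         integral {0..1} (\<lambda>t. arctan (t powr (1/a)) / (1 + t\<^sup>2)) = pi\<^sup>2 / 16"
proof -
  define f where "f b t = arctan (t powr b) / (1 + t\<^sup>2)" for b t :: real
  define F where "F s = integral {0..s} (f a)" for s
  define G where "G s = integral {0..s} (f (1/a))" for s
  define H where "H s = F s + G (s powr a) - arctan s * arctan (s powr a)" for s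
  have cont: "continuous_on {0..1} (f b)" if "b > 0" for b
    using continuous_on_real_T_integrand[OF that] by (simp add: f_def[abs_def])
  have contI: "continuous_on {0..1} (\<lambda>s. integral {0..s} (f b))" if "b > 0" for b
    by (intro indefinite_integral_continuous_1 integrable_continuous_interval cont that)
  have derivI: "((\<lambda>s. integral {0..s} (f b)) has_real_derivative f b s) (at s)"
    if "b > 0" "0 < s" "s < 1" for b s
    using integral_has_real_derivative[OF cont[OF \<open>b > 0\<close>], of s] that
    by (simp add: at_within_Icc_at)
  have cont_powr: "continuous_on {0..1} (\<lambda>s. s powr a)"
    using assms by (intro continuous_on_powr' continuous_intros) auto
  have "H 1 = H 0"
  proof (rule DERIV_isconst_end[of 0 1 H])
    have "continuous_on {0..1} (\<lambda>s. G (s powr a))"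
      unfolding G_def using assms
      by (intro continuous_on_compose2[OF contI cont_powr]) (auto simp: powr_le1)
    then show "continuous_on {0..1} H"
      unfolding H_def[abs_def] F_def using assms
      by (intro continuous_intros contI cont_powr) auto
  next
    fix s :: real assume s: "0 < s" "s < 1"
    have s': "0 < s powr a" "s powr a < 1"
      using s assms powr_less_mono2[of a s 1] by auto
    have powr: "((\<lambda>s. s powr a) has_real_derivative a * s powr (a - 1)) (at s)"
      using s(1) by (rule has_real_derivative_powr)
    have "(F has_real_derivative f a s) (at s)"
      unfolding F_def[abs_def] using derivI assms s by blast
    moreover have "((\<lambda>s. G (s powr a)) has_real_derivative
             f (1/a) (s powr a) * (a * s powr (a - 1))) (at s)"
      unfolding G_def[abs_def] using assms s'
      by (intro DERIV_chain2[OF derivI powr]) auto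
    moreover have "((\<lambda>s. arctan s * arctan (s powr a)) has_real_derivative
             inverse (1 + s\<^sup>2) * arctan (s powr a) +
             inverse (1 + (s powr a)\<^sup>2) * (a * s powr (a - 1)) * arctan s) (at s)"
      by (intro DERIV_mult DERIV_arctan DERIV_chain2[OF DERIV_arctan powr])
    ultimately have "(H has_real_derivative
             f a s + f (1/a) (s powr a) * (a * s powr (a - 1)) -
             (inverse (1 + s\<^sup>2) * arctan (s powr a) +
              inverse (1 + (s powr a)\<^sup>2) * (a * s powr (a - 1)) * arctan s)) (at s)"
      unfolding H_def[abs_def] by (intro DERIV_diff DERIV_add)
    moreover have "(s powr a) powr (1/a) = s"
      using s assms by (simp add: powr_powr)
    ultimately show "(H has_real_derivative 0) (at s)"
      by (simp add: f_def divide_inverse mult_ac)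
  qed simp
  then have "F 1 + G 1 = (pi/4) * (pi/4)"
    by (simp add: H_def F_def G_def arctan_one)
  then show ?thesis
    by (simp add: F_def G_def f_def[abs_def] power2_eq_square)
qed

lemma T_reflection_real:
  fixes a :: real
  assumes "a > 0"
  shows "T (of_real a) + T (1 / of_real a) = of_real (pi\<^sup>2 / 16)"
proof -
  have "T (1 / of_real a) = T (of_real (1/a))"
    by simp
  then show ?thesis
    using assms
    by (simp only: T_of_real divide_pos_pos zero_less_one integral_arctan_powr_reflection
             flip: of_real_add)
qed

section \<open>Analytic continuation\<close>

theorem theorem4p3:
  fixes x :: complex
  assumes "Re x > 0"
  shows "T x + T (1 / x) = of_real (pi\<^sup>2 / 16)"
proof -
  define S where "S = {x. Re x > 0}"
  define h where "h x = T x + T (1 / x) - of_real (pi\<^sup>2 / 16)" for x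
  have inv: "1 / z \<in> S" if "z \<in> S" for z
    using that by (auto simp: S_def Re_divide intro!: divide_pos_pos add_pos_nonneg)
  have "(\<lambda>z. 1 / z) holomorphic_on S"
    by (intro holomorphic_intros) (auto simp: S_def)
  then have "(T \<circ> (\<lambda>z. 1 / z)) holomorphic_on S"
    using T_holomorphic inv by (intro holomorphic_on_compose_gen[where t = S]) (auto simp: S_def)
  then have hol: "h holomorphic_on S"
    using T_holomorphic unfolding h_def[abs_def] S_def o_def
    by (intro holomorphic_intros)
  have "h x = 0"
  proof (rule analytic_continuation[OF hol, of "of_real ` {0<..}" 1])
    show "open S" "connected S"
      unfolding S_def
      by (auto intro: open_halfspace_Re_gt convex_connected convex_halfspace_Re_gt)
    show "(1::complex) islimpt of_real ` {0<..}"
      unfolding islimpt_sequential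
    proof (intro exI conjI allI)
      show "of_real (1 + inverse (real (Suc n))) \<in> of_real ` {0<..} - {1::complex}" for n
        by (auto simp: add_pos_pos simp del: of_real_add of_nat_Suc)
      have "(\<lambda>n. 1 + inverse (real (Suc n))) \<longlonglongrightarrow> 1 + 0"
        by (intro tendsto_intros LIMSEQ_inverse_real_of_nat)
      then show "(\<lambda>n. of_real (1 + inverse (real (Suc n)))) \<longlonglongrightarrow> (1::complex)"
        using tendsto_of_real[where 'a = complex] by fastforce
    qed
    show "h z = 0" if "z \<in> of_real ` {0<..}" for z
      using that T_reflection_real by (auto simp: h_def)
  qed (use assms in \<open>auto simp: S_def\<close>)
  then show ?thesis
    by (simp add: h_def)
qed

end
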